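(* Let $n$ be a positive integer. Then $n\mathbb{Z}$ is a quasi sdf-absorbing ideal of $\mathbb{Z}$ if and only if there is an odd prime $q$ such that either $n=q^{m}$ for some integer $m\geq 1$, or $n=2^{k}q^{m}$ for some integers $k\geq 1$ and $m\geq 0$.
   Context: All rings are commutative with identity. An ideal $I$ of a ring $R$ is called sdf-absorbing if for all non-zero $a,b\in R$, $a^{2}-b^{2}\in I$ implies $a-b\in I$ or $a+b\in I$. A proper ideal $I$ of $R$ is called quasi sdf-absorbing if its radical $\sqrt{I}$ is an sdf-absorbing ideal of $R$. *)

theory Defs
  imports "HOL-Algebra.IntRing"
begin

definition ideal_radical :: "('a, 'b) ring_scheme \<Rightarrow> 'a set \<Rightarrow> 'a set" where
  "ideal_radical R I = {x \<in> carrier R. \<exists>k::nat. k \<ge> 1 \<and> x [^]\<^bsub>R\<^esub> k \<in> I}"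

text \<open>An sdf-absorbing ideal is not required to be proper; properness enters only in the
  quasi version.\<close>

definition sdf_absorbing_ideal :: "'a set \<Rightarrow> ('a, 'b) ring_scheme \<Rightarrow> bool" where
  "sdf_absorbing_ideal I R \<longleftrightarrow> cring R \<and> ideal I R \<and>
     (\<forall>a \<in> carrier R - {\<zero>\<^bsub>R\<^esub>}. \<forall>b \<in> carrier R - {\<zero>\<^bsub>R\<^esub>}.
        a [^]\<^bsub>R\<^esub> (2::nat) \<ominus>\<^bsub>R\<^esub> b [^]\<^bsub>R\<^esub> (2::nat) \<in> I \<longrightarrow>
        a \<ominus>\<^bsub>R\<^esub> b \<in> I \<or> a \<oplus>\<^bsub>R\<^esub> b \<in> I)"

definition quasi_sdf_absorbing_ideal :: "'a set \<Rightarrow> ('a, 'b) ring_scheme \<Rightarrow> bool" where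
  "quasi_sdf_absorbing_ideal I R \<longleftrightarrow> cring R \<and> ideal I R \<and> I \<noteq> carrier R \<and>
     sdf_absorbing_ideal (ideal_radical R I) R"

end

theory Submission
  imports Defs
begin

text \<open>The radical of \<open>n\<int>\<close> consists of the integers divisible by every prime divisor of \<open>n\<close>.
  If \<open>n\<close> has at most one odd prime divisor \<open>q\<close>, then \<open>a - b\<close> and \<open>a + b\<close> have the same parity
  and \<open>q\<close> divides one of them, so one of them lies in the radical. If \<open>p \<noteq> q\<close> are odd prime
  divisors of \<open>n = p\<^sup>i r\<close> with \<open>p\<close> not dividing \<open>r\<close>, then \<open>a = p\<^sup>i + r\<close> and \<open>b = p\<^sup>i - r\<close> violate the
  condition, since \<open>a\<^sup>2 - b\<^sup>2 = 4n\<close>, \<open>a - b = 2r\<close> and \<open>a + b = 2p\<^sup>i\<close>.\<close>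

lemma even_prime_int_eq_2: "prime p \<Longrightarrow> even p \<Longrightarrow> p = 2" for p :: int
  by (rule primes_dvd_imp_eq[symmetric]) simp_all

text \<open>A prime dividing a power of \<open>x\<close> divides \<open>x\<close>. Conversely,
  building \<open>n\<close> up prime by prime, each prime factor costs one more power of
  \<open>x\<close>.\<close>

lemma dvd_power_iff_prime_divisors_dvd:
  fixes n x :: int
  assumes "n \<noteq> 0"
  shows "(\<exists>k\<ge>1. n dvd x ^ k) \<longleftrightarrow> (\<forall>p. prime p \<longrightarrow> p dvd n \<longrightarrow> p dvd x)"
proof
  assume "\<exists>k\<ge>1. n dvd x ^ k"
  then show "\<forall>p. prime p \<longrightarrow> p dvd n \<longrightarrow> p dvd x"
    by (meson dvd_trans prime_dvd_power)
next
  assume "\<forall>p. prime p \<longrightarrow> p dvd n \<longrightarrow> p dvd x"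
  with assms show "\<exists>k\<ge>1. n dvd x ^ k"
  proof (induction n rule: prime_divisors_induct)
    case zero
    then show ?case by simp
  next
    case (unit u)
    then show ?case by (intro exI[of _ 1]) (auto intro: unit_imp_dvd)
  next
    case (factor p m)
    then obtain k where "m dvd x ^ k" by auto
    moreover have "p dvd x" using factor by auto
    ultimately have "p * m dvd x ^ Suc k" by (simp add: mult_dvd_mono)
    then show ?case by (intro exI[of _ "Suc k"]) simp
  qed
qed

lemma int_nat_pow_eq: "x [^]\<^bsub>\<Z>\<^esub> (k::nat) = x ^ k"
  by (induction k) simp_all

lemma mem_int_PIdl_iff: "x \<in> PIdl\<^bsub>\<Z>\<^esub> n \<longleftrightarrow> n dvd x"
  by (auto simp: cgenideal_def dvd_def mult.commute)

lemma int_ideal_radical_PIdl: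
  assumes "n \<noteq> 0"
  shows "ideal_radical \<Z> (PIdl\<^bsub>\<Z>\<^esub> n) = {x. \<forall>p. prime p \<longrightarrow> p dvd n \<longrightarrow> p dvd x}"
  using dvd_power_iff_prime_divisors_dvd[OF assms]
  by (auto simp: ideal_radical_def mem_int_PIdl_iff int_nat_pow_eq)

text \<open>Supplies the ideal condition inside \<open>sdf_absorbing_ideal\<close> for the radical:
  divisibility by a fixed \<open>p\<close> survives sums, negation and multiples.\<close>

lemma ideal_prime_divisors_dvd:
  fixes n :: int
  shows "ideal {x. \<forall>p. prime p \<longrightarrow> p dvd n \<longrightarrow> p dvd x} \<Z>"
proof (rule idealI)
  show "subgroup {x. \<forall>p. prime p \<longrightarrow> p dvd n \<longrightarrow> p dvd x} (add_monoid \<Z>)"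
    \<comment> \<open>Unfolding \<open>a_inv_def\<close> turns \<open>int_a_inv_eq\<close> into a
      fact about inverses in \<open>add_monoid \<Z>\<close>.\<close>
    using int_a_inv_eq by (intro subgroup.intro) (auto simp: a_inv_def)
qed (auto intro: int.ring_axioms)

text \<open>Moves the problem from ideals to prime divisors, where both directions are argued;
  \<open>n \<noteq> 1\<close> expresses properness.\<close>

lemma quasi_sdf_absorbing_int_PIdl_iff:
  fixes n :: int
  assumes "n > 0"
  shows "quasi_sdf_absorbing_ideal (PIdl\<^bsub>\<Z>\<^esub> n) \<Z> \<longleftrightarrow> n \<noteq> 1 \<and>
    (\<forall>a b. a \<noteq> 0 \<longrightarrow> b \<noteq> 0 \<longrightarrow>
       (\<forall>p. prime p \<longrightarrow> p dvd n \<longrightarrow> p dvd a\<^sup>2 - b\<^sup>2) \<longrightarrow>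
       (\<forall>p. prime p \<longrightarrow> p dvd n \<longrightarrow> p dvd a - b) \<or>
       (\<forall>p. prime p \<longrightarrow> p dvd n \<longrightarrow> p dvd a + b))"
proof -
  have proper: "PIdl\<^bsub>\<Z>\<^esub> n \<noteq> carrier \<Z> \<longleftrightarrow> n \<noteq> 1"
    using assms by (auto simp: set_eq_iff mem_int_PIdl_iff intro: exI[of _ 1])
  have rad: "ideal_radical \<Z> (PIdl\<^bsub>\<Z>\<^esub> n) = {x. \<forall>p. prime p \<longrightarrow> p dvd n \<longrightarrow> p dvd x}"
    using assms by (simp add: int_ideal_radical_PIdl)
  have "ideal (PIdl\<^bsub>\<Z>\<^esub> n) \<Z>" by (simp add: int.cgenideal_ideal)
  then show ?thesis
    unfolding quasi_sdf_absorbing_ideal_def sdf_absorbing_ideal_def proper rad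
      int_a_minus_eq int_nat_pow_eq
    using ideal_prime_divisors_dvd[of n] int_is_cring
    by (simp add: Ball_def)
qed

lemma quasi_sdf_absorbing_int_PIdl_if_unique_odd_prime_divisor:
  fixes n q :: int
  assumes "n > 1" and q: "\<And>p. prime p \<Longrightarrow> p dvd n \<Longrightarrow> p = 2 \<or> p = q"
  shows "quasi_sdf_absorbing_ideal (PIdl\<^bsub>\<Z>\<^esub> n) \<Z>"
proof -
  have "(\<forall>p. prime p \<longrightarrow> p dvd n \<longrightarrow> p dvd a - b) \<or> (\<forall>p. prime p \<longrightarrow> p dvd n \<longrightarrow> p dvd a + b)"
    if *: "\<forall>p. prime p \<longrightarrow> p dvd n \<longrightarrow> p dvd a\<^sup>2 - b\<^sup>2" for a b :: int
  proof -
    have even: "even (a - b)" "even (a + b)" if "prime (2::int)" "2 dvd n"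
      using * that by (auto dest!: spec[of _ 2])
    have "q dvd a - b \<or> q dvd a + b" if "prime q" "q dvd n"
    proof -
      have "q dvd (a - b) * (a + b)"
        using * that by (simp add: power2_eq_square algebra_simps)
      then show ?thesis using that prime_dvd_multD by blast
    qed
    then show ?thesis using even q by blast
  qed
  then show ?thesis using assms(1) by (simp add: quasi_sdf_absorbing_int_PIdl_iff)
qed

lemma odd_prime_divisor_unique_if_quasi_sdf_absorbing:
  fixes n p q :: int
  assumes "n > 0" and sdf: "quasi_sdf_absorbing_ideal (PIdl\<^bsub>\<Z>\<^esub> n) \<Z>"
    and p: "prime p" "odd p" "p dvd n" and q: "prime q" "odd q" "q dvd n"
  shows "p = q"
proof (rule ccontr)
  assume "p \<noteq> q"
  define i where "i = multiplicity p n"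
  obtain r where r: "n = p ^ i * r" "\<not> p dvd r"
    unfolding i_def using assms(1) p(1) by (metis multiplicity_decompose' not_prime_unit less_irrefl)
  have "i \<noteq> 0" using p r by (intro notI) auto
  then have "p dvd p ^ i" by simp
  have nq: "\<not> q dvd p ^ i"
    using \<open>p \<noteq> q\<close> primes_dvd_imp_eq[OF q(1) p(1)] prime_dvd_power[OF q(1)] by blast
  have "\<not> p dvd 2" "\<not> q dvd 2"
    using p q primes_dvd_imp_eq[of p 2] primes_dvd_imp_eq[of q 2] by auto
  \<comment> \<open>The condition only concerns non-zero elements. If either were zero,
    \<open>p\<close> would divide \<open>r\<close>.\<close>
  have "p ^ i + r \<noteq> 0" "p ^ i - r \<noteq> 0"
    using r(2) \<open>p dvd p ^ i\<close> by (auto simp: add_eq_0_iff)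
  moreover have "(p ^ i + r)\<^sup>2 - (p ^ i - r)\<^sup>2 = 4 * n"
    by (simp add: r(1) power2_eq_square algebra_simps)
  then have "\<forall>t. prime t \<longrightarrow> t dvd n \<longrightarrow> t dvd (p ^ i + r)\<^sup>2 - (p ^ i - r)\<^sup>2"
    by simp
  \<comment> \<open>The first alternative is tested at \<open>p\<close>, the second at
    \<open>q\<close>; both tests fail.\<close>
  ultimately have "p dvd (p ^ i + r) - (p ^ i - r) \<or> q dvd (p ^ i + r) + (p ^ i - r)"
    using sdf p q unfolding quasi_sdf_absorbing_int_PIdl_iff[OF \<open>n > 0\<close>]
    by blast
  then have "p dvd 2 * r \<or> q dvd 2 * p ^ i" by simp
  then show False
    using prime_dvd_multD[OF p(1)] prime_dvd_multD[OF q(1)] \<open>\<not> p dvd 2\<close> \<open>\<not> q dvd 2\<close> r(2) nq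
    by blast
qed

text \<open>Splitting off the full powers of 2 and then of \<open>q\<close> leaves a positive
  cofactor without prime divisors, hence 1.\<close>

lemma int_eq_power_mult_power_if_prime_divisors:
  fixes n q :: int
  assumes "n > 0" "prime q" and "\<And>p. prime p \<Longrightarrow> p dvd n \<Longrightarrow> p = 2 \<or> p = q"
  shows "\<exists>k m. n = 2 ^ k * q ^ m"
proof -
  have two: "prime (2::int)" by simp
  obtain k r where r: "n = 2 ^ k * r" "odd r"
    using assms(1) by (metis multiplicity_decompose' not_prime_unit two less_irrefl)
  then have "r \<noteq> 0" by auto
  then obtain m s where s: "r = q ^ m * s" "\<not> q dvd s"
    using \<open>prime q\<close> by (metis multiplicity_decompose' not_prime_unit)
  have "s > 0"
    using \<open>n > 0\<close> r(1) s(1) prime_gt_0_int[OF \<open>prime q\<close>]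
    by (metis zero_less_mult_pos zero_less_numeral zero_less_power)
  moreover have "\<not> prime p" if "p dvd s" for p
    using that assms(3)[of p] r s by (metis dvd_mult)
  ultimately have "s = 1"
    using prime_divisor_exists[of s] by auto
  then show ?thesis using r s by auto
qed

theorem theorem2p2:
  fixes n :: int
  assumes "n > 0"
  shows "quasi_sdf_absorbing_ideal (PIdl\<^bsub>\<Z>\<^esub> n) \<Z> \<longleftrightarrow>
    (\<exists>q::int. prime q \<and> odd q \<and>
       ((\<exists>m::nat. m \<ge> 1 \<and> n = q ^ m) \<or>
        (\<exists>k m :: nat. k \<ge> 1 \<and> m \<ge> 0 \<and> n = 2 ^ k * q ^ m)))"
    (is "?L \<longleftrightarrow> ?R")
proof
  assume ?L
  have "\<exists>q. prime q \<and> odd q \<and> (\<forall>p. prime p \<longrightarrow> p dvd n \<longrightarrow> p = 2 \<or> p = q)"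
  proof (cases "\<exists>q. prime q \<and> odd q \<and> q dvd n")
    case True
    then show ?thesis
      using odd_prime_divisor_unique_if_quasi_sdf_absorbing[OF assms \<open>?L\<close>]
      by (metis even_prime_int_eq_2)
  next
    case False
    \<comment> \<open>Here 2 is the only possible prime divisor of \<open>n\<close>, so any odd
      prime can serve as \<open>q\<close>.\<close>
    have "prime (3::int)" by simp
    moreover have "odd (3::int)" by simp
    ultimately show ?thesis using False by (metis even_prime_int_eq_2)
  qed
  then obtain q k m where q: "prime q" "odd q" and n: "n = 2 ^ k * q ^ m"
    using int_eq_power_mult_power_if_prime_divisors[OF assms] by metis
  \<comment> \<open>This excludes \<open>k = m = 0\<close>, so \<open>k = 0\<close> forces
    \<open>m \<ge> 1\<close>.\<close>
  have "n \<noteq> 1" using \<open>?L\<close> assms by (simp add: quasi_sdf_absorbing_int_PIdl_iff)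
  show ?R
  proof (cases k)
    case 0
    with \<open>n \<noteq> 1\<close> n have "n = q ^ m" "m \<ge> 1" by (cases m; simp)+
    then show ?thesis using q by blast
  next
    case (Suc j)
    then have "k \<ge> 1" "m \<ge> 0" by simp_all
    then show ?thesis using q n by blast
  qed
next
  assume ?R
  \<comment> \<open>The factor \<open>2 ^ 0\<close> gives both alternatives the same shape, so they
    can be treated together.\<close>
  then obtain q :: int where q: "prime q" and
    "(\<exists>m\<ge>1. n = 2 ^ 0 * q ^ m) \<or> (\<exists>k m. k \<ge> 1 \<and> n = 2 ^ k * q ^ m)"
    unfolding power_0 mult_1 by blast
  then obtain k m :: nat where n: "n = 2 ^ k * q ^ m" and "k \<ge> 1 \<or> m \<ge> 1"
    by blast
  have two: "prime (2::int)" by simp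
  have "p = 2 \<or> p = q" if "prime p" "p dvd n" for p
  proof -
    have "p dvd 2 \<or> p dvd q"
      using that unfolding n by (meson prime_dvd_mult_iff prime_dvd_power)
    then show ?thesis using primes_dvd_imp_eq \<open>prime p\<close> q two by blast
  qed
  moreover have "n \<noteq> 1"
  proof -
    have "2 dvd n \<or> q dvd n" using n \<open>k \<ge> 1 \<or> m \<ge> 1\<close> by auto
    then show ?thesis using q by auto
  qed
  ultimately show ?L
    using assms by (intro quasi_sdf_absorbing_int_PIdl_if_unique_odd_prime_divisor) auto
qed

end
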